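(* Let $G$ be a finite group with identity $e$. Then the subgraph $\Gamma(G)[G\setminus\{e\}]$ of the coprime graph $\Gamma(G)$ induced by $G\setminus\{e\}$ satisfies $\Gamma(G)[G\setminus\{e\}]\cong\mathcal{O}_G[\mathbb{L}_G]$. In particular, $\Gamma(G)$ is also a generalized lexicographic product, and $\Gamma(G)\cong K_1\vee\mathcal{O}_G[\mathbb{L}_G]$.
   Context: All graphs are simple and undirected. The coprime graph $\Gamma(G)$ has vertex set $G$, and two distinct vertices $x,y$ are adjacent if and only if $\gcd(o(x),o(y))=1$, where $o(x)$ is the order of $x$. For $a\in G$, $\pi(a)$ is the set of prime divisors of $o(a)$. For $a,b\in G\setminus\{e\}$ write $a\circeq b$ if $\pi(a)=\pi(b)$; this is an equivalence relation, and $[a]$ denotes the class of $a$. Let $\widetilde{G}=\{[a]: a\in G\setminus\{e\}\}$. The graph $\mathcal{O}_G$ has vertex set $\widetilde{G}$, and distinct $[a],[b]$ are adjacent if and only if $\pi(a)\cap\pi(b)=\emptyset$. For $[a]\in\widetilde{G}$, $\mathcal{F}_{[a]}$ is the subgraph of $\Gamma(G)$ induced by $[a]$ (it has no edges), and $\mathbb{L}_G=\{\mathcal{F}_{[a]}:[a]\in V(\mathcal{O}_G)\}$. For a graph $\mathcal{H}$ and a family of graphs $\mathbb{F}=\{\mathcal{F}_v:v\in V(\mathcal{H})\}$, the generalized lexicographic product $\mathcal{H}[\mathbb{F}]$ has vertex set $\{(v,w):v\in V(\mathcal{H}),w\in V(\mathcal{F}_v)\}$, with $(v_1,w_1),(v_2,w_2)$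 adjacent if and only if $\{v_1,v_2\}\in E(\mathcal{H})$, or $v_1=v_2$ and $\{w_1,w_2\}\in E(\mathcal{F}_{v_1})$. $K_1$ is the one-vertex graph, and $\Gamma_1\vee\Gamma_2$ is the sum (join) of vertex-disjoint graphs: their union together with all edges between $V(\Gamma_1)$ and $V(\Gamma_2)$. *)

theory Defs
  imports "HOL-Algebra.Multiplicative_Group" "HOL-Computational_Algebra.Primes"
begin

section \<open>Simple undirected graphs\<close>

record 'v ugraph =
  gverts :: "'v set"
  gedges :: "'v set set"

definition simple_graph :: "'v ugraph \<Rightarrow> bool" where
  "simple_graph \<Gamma> \<longleftrightarrow>
     gedges \<Gamma> \<subseteq> {{x, y} | x y. x \<in> gverts \<Gamma> \<and> y \<in> gverts \<Gamma> \<and> x \<noteq> y}"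

definition induced_subgraph :: "'v ugraph \<Rightarrow> 'v set \<Rightarrow> 'v ugraph" where
  "induced_subgraph \<Gamma> S = \<lparr> gverts = gverts \<Gamma> \<inter> S, gedges = {e \<in> gedges \<Gamma>. e \<subseteq> S} \<rparr>"

definition graph_iso :: "'v ugraph \<Rightarrow> 'w ugraph \<Rightarrow> bool" where
  "graph_iso \<Gamma> \<Delta> \<longleftrightarrow>
     (\<exists>f. bij_betw f (gverts \<Gamma>) (gverts \<Delta>) \<and>
          (\<forall>x \<in> gverts \<Gamma>. \<forall>y \<in> gverts \<Gamma>. {x, y} \<in> gedges \<Gamma> \<longleftrightarrow> {f x, f y} \<in> gedges \<Delta>))"

text \<open>The graph \<open>K\<^sub>1\<close> with vertex \<open>v\<close>.\<close>

definition K1 :: "'v \<Rightarrow> 'v ugraph" where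
  "K1 v = \<lparr> gverts = {v}, gedges = {} \<rparr>"

text \<open>The two summands are made vertex-disjoint by tagging their vertices with
  \<open>Inl\<close> and \<open>Inr\<close>.\<close>

definition graph_join :: "'v ugraph \<Rightarrow> 'w ugraph \<Rightarrow> ('v + 'w) ugraph" where
  "graph_join \<Gamma> \<Delta> =
     \<lparr> gverts = Inl ` gverts \<Gamma> \<union> Inr ` gverts \<Delta>,
       gedges = (`) Inl ` gedges \<Gamma> \<union> (`) Inr ` gedges \<Delta>
                \<union> {{Inl x, Inr y} | x y. x \<in> gverts \<Gamma> \<and> y \<in> gverts \<Delta>} \<rparr>"

text \<open>A family of graphs indexed by the vertices of \<open>H\<close> is a function on the vertex type;
  its values outside \<open>gverts H\<close> are not used.\<close>

definition gen_lex_product :: "'v ugraph \<Rightarrow> ('v \<Rightarrow> 'w ugraph) \<Rightarrow> ('v \<times> 'w) ugraph" where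
  "gen_lex_product H F =
     \<lparr> gverts = {(v, w). v \<in> gverts H \<and> w \<in> gverts (F v)},
       gedges = {{(v\<^sub>1, w\<^sub>1), (v\<^sub>2, w\<^sub>2)} | v\<^sub>1 w\<^sub>1 v\<^sub>2 w\<^sub>2.
                   v\<^sub>1 \<in> gverts H \<and> w\<^sub>1 \<in> gverts (F v\<^sub>1) \<and>
                   v\<^sub>2 \<in> gverts H \<and> w\<^sub>2 \<in> gverts (F v\<^sub>2) \<and>
                   ({v\<^sub>1, v\<^sub>2} \<in> gedges H \<or> v\<^sub>1 = v\<^sub>2 \<and> {w\<^sub>1, w\<^sub>2} \<in> gedges (F v\<^sub>1))} \<rparr>"


section \<open>Graphs attached to a group\<close>

definition coprime_graph :: "('a, 'b) monoid_scheme \<Rightarrow> 'a ugraph" where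
  "coprime_graph G =
     \<lparr> gverts = carrier G,
       gedges = {{x, y} | x y. x \<in> carrier G \<and> y \<in> carrier G \<and> x \<noteq> y \<and>
                               gcd (group.ord G x) (group.ord G y) = 1} \<rparr>"

definition order_primes :: "('a, 'b) monoid_scheme \<Rightarrow> 'a \<Rightarrow> nat set" where
  "order_primes G a = {p. prime p \<and> p dvd group.ord G a}"

definition nonidentity :: "('a, 'b) monoid_scheme \<Rightarrow> 'a set" where
  "nonidentity G = carrier G - {\<one>\<^bsub>G\<^esub>}"

definition same_primes_rel :: "('a, 'b) monoid_scheme \<Rightarrow> ('a \<times> 'a) set" where
  "same_primes_rel G =
     {(a, b). a \<in> nonidentity G \<and> b \<in> nonidentity G \<and> order_primes G a = order_primes G b}"

lemma equiv_same_primes_rel: "equiv (nonidentity G) (same_primes_rel G)"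
  by (auto simp: same_primes_rel_def intro!: equivI refl_onI symI transI)

definition order_class_graph :: "('a, 'b) monoid_scheme \<Rightarrow> 'a set ugraph" where
  "order_class_graph G =
     \<lparr> gverts = nonidentity G // same_primes_rel G,
       gedges = {{same_primes_rel G `` {a}, same_primes_rel G `` {b}} | a b.
                   a \<in> nonidentity G \<and> b \<in> nonidentity G \<and>
                   same_primes_rel G `` {a} \<noteq> same_primes_rel G `` {b} \<and>
                   order_primes G a \<inter> order_primes G b = {}} \<rparr>"

text \<open>The family \<open>\<L>\<^sub>G\<close>: the class \<open>A\<close> is sent to the subgraph of \<open>\<Gamma>(G)\<close> induced by \<open>A\<close>.\<close>

definition class_family :: "('a, 'b) monoid_scheme \<Rightarrow> 'a set \<Rightarrow> 'a ugraph" where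
  "class_family G A = induced_subgraph (coprime_graph G) A"

end

theory Submission
  imports Defs
begin

text \<open>
  In a finite group every order is positive, so \<open>gcd (o(x), o(y)) = 1\<close> says exactly that
  \<open>\<pi>(x)\<close> and \<open>\<pi>(y)\<close> are disjoint: adjacency of \<open>x\<close> and \<open>y\<close> in the coprime graph depends
  only on their classes \<open>[x]\<close> and \<open>[y]\<close>. For \<open>x \<noteq> e\<close> the set \<open>\<pi>(x)\<close> is nonempty, hence no
  two vertices of one class are adjacent, and vertices whose prime sets are disjoint lie in
  different classes. Therefore \<open>x \<mapsto> ([x], x)\<close> is an isomorphism from the graph on
  \<open>G - {e}\<close> to \<open>\<O>\<^sub>G[\<L>\<^sub>G]\<close> (lemma \<open>nonidentity_iso_gen_lex_product\<close>).

  The identity has order 1 and is thus adjacent to every other vertex. A simple graph with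
  such a dominating vertex is the sum of \<open>K\<^sub>1\<close> and the graph on the remaining vertices
  (\<open>dominating_vertex_iso_join\<close>), which gives \<open>\<Gamma>(G) \<cong> K\<^sub>1 \<or> \<O>\<^sub>G[\<L>\<^sub>G]\<close>. A sum \<open>K\<^sub>1 \<or> H[F]\<close> is in turn
  the generalized lexicographic product over \<open>K\<^sub>1 \<or> H\<close> whose family has one further
  member \<open>K\<^sub>1\<close> (\<open>join_K1_gen_lex_product_iso\<close>); this exhibits \<open>\<Gamma>(G)\<close> itself as such a product.
\<close>

section \<open>Sums and generalized lexicographic products\<close>

lemma graph_iso_trans:
  assumes "graph_iso \<Gamma> \<Delta>" and "graph_iso \<Delta> \<Theta>"
  shows "graph_iso \<Gamma> \<Theta>"
proof -
  obtain f where f: "bij_betw f (gverts \<Gamma>) (gverts \<Delta>)"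
      "\<And>x y. x \<in> gverts \<Gamma> \<Longrightarrow> y \<in> gverts \<Gamma> \<Longrightarrow> {x, y} \<in> gedges \<Gamma> \<longleftrightarrow> {f x, f y} \<in> gedges \<Delta>"
    using assms(1) by (auto simp: graph_iso_def)
  obtain g where g: "bij_betw g (gverts \<Delta>) (gverts \<Theta>)"
      "\<And>x y. x \<in> gverts \<Delta> \<Longrightarrow> y \<in> gverts \<Delta> \<Longrightarrow> {x, y} \<in> gedges \<Delta> \<longleftrightarrow> {g x, g y} \<in> gedges \<Theta>"
    using assms(2) by (auto simp: graph_iso_def)
  have "f x \<in> gverts \<Delta>" if "x \<in> gverts \<Gamma>" for x
    using f(1) that by (auto simp: bij_betw_def)
  then show ?thesis
    unfolding graph_iso_def
    using bij_betw_trans[OF f(1) g(1)] f(2) g(2) by (intro exI[of _ "g \<circ> f"]) simp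
qed

lemma simple_graph_not_loop: "simple_graph \<Gamma> \<Longrightarrow> {x} \<notin> gedges \<Gamma>"
  by (auto simp: simple_graph_def)

lemma simple_graph_K1: "simple_graph (K1 v)"
  by (simp add: simple_graph_def K1_def)

lemma simple_graph_induced_subgraph:
  assumes "simple_graph \<Gamma>"
  shows "simple_graph (induced_subgraph \<Gamma> S)"
  unfolding simple_graph_def
proof
  fix e assume "e \<in> gedges (induced_subgraph \<Gamma> S)"
  then have e: "e \<in> gedges \<Gamma>" "e \<subseteq> S" by (simp_all add: induced_subgraph_def)
  with assms obtain x y where "x \<in> gverts \<Gamma>" "y \<in> gverts \<Gamma>" "x \<noteq> y" "e = {x, y}"
    by (auto simp: simple_graph_def)
  with e show "e \<in> {{x, y} | x y. x \<in> gverts (induced_subgraph \<Gamma> S) \<and>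
      y \<in> gverts (induced_subgraph \<Gamma> S) \<and> x \<noteq> y}"
    by (intro CollectI exI[of _ x] exI[of _ y]) (simp add: induced_subgraph_def)
qed

lemma simple_graph_join:
  assumes "simple_graph \<Gamma>" and "simple_graph \<Delta>"
  shows "simple_graph (graph_join \<Gamma> \<Delta>)"
  unfolding simple_graph_def
proof
  fix e assume "e \<in> gedges (graph_join \<Gamma> \<Delta>)"
  then consider d where "e = Inl ` d" "d \<in> gedges \<Gamma>" | d where "e = Inr ` d" "d \<in> gedges \<Delta>"
    | x y where "e = {Inl x, Inr y}" "x \<in> gverts \<Gamma>" "y \<in> gverts \<Delta>"
    unfolding graph_join_def by auto
  then show "e \<in> {{x, y} | x y. x \<in> gverts (graph_join \<Gamma> \<Delta>) \<and>
      y \<in> gverts (graph_join \<Gamma> \<Delta>) \<and> x \<noteq> y}"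
  proof cases
    case (1 d)
    then obtain x y where "x \<in> gverts \<Gamma>" "y \<in> gverts \<Gamma>" "x \<noteq> y" "d = {x, y}"
      using assms(1) by (auto simp: simple_graph_def)
    with 1 show ?thesis
      by (intro CollectI exI[of _ "Inl x"] exI[of _ "Inl y"]) (simp add: graph_join_def)
  next
    case (2 d)
    then obtain x y where "x \<in> gverts \<Delta>" "y \<in> gverts \<Delta>" "x \<noteq> y" "d = {x, y}"
      using assms(2) by (auto simp: simple_graph_def)
    with 2 show ?thesis
      by (intro CollectI exI[of _ "Inr x"] exI[of _ "Inr y"]) (simp add: graph_join_def)
  next
    case (3 x y)
    then show ?thesis
      by (intro CollectI exI[of _ "Inl x"] exI[of _ "Inr y"]) (simp add: graph_join_def)
  qed
qed

lemma inj_image_mem_image_iff: "inj f \<Longrightarrow> f ` e \<in> (`) f ` E \<longleftrightarrow> e \<in> E"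
  by (auto simp: inj_image_eq_iff)

lemma join_edge_Inl_Inl: "{Inl x, Inl x'} \<in> gedges (graph_join \<Gamma> \<Delta>) \<longleftrightarrow> {x, x'} \<in> gedges \<Gamma>"
  using inj_image_mem_image_iff[OF inj_Inl, of "{x, x'}" "gedges \<Gamma>"]
  by (auto simp: graph_join_def doubleton_eq_iff)

lemma join_edge_Inr_Inr: "{Inr y, Inr y'} \<in> gedges (graph_join \<Gamma> \<Delta>) \<longleftrightarrow> {y, y'} \<in> gedges \<Delta>"
  using inj_image_mem_image_iff[OF inj_Inr, of "{y, y'}" "gedges \<Delta>"]
  by (auto simp: graph_join_def doubleton_eq_iff)

lemma join_edge_Inl_Inr:
  assumes "x \<in> gverts \<Gamma>" and "y \<in> gverts \<Delta>"
  shows "{Inl x, Inr y} \<in> gedges (graph_join \<Gamma> \<Delta>)"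
    and "{Inr y, Inl x} \<in> gedges (graph_join \<Gamma> \<Delta>)"
  using assms by (auto simp: graph_join_def insert_commute)

text \<open>
  An edge is an unordered pair, so it matches the set-builder form of the product in two ways;
  the condition is symmetric under exchanging the endpoints, which makes both agree.
\<close>

lemma gen_lex_product_edge_iff:
  assumes "v \<in> gverts H" "w \<in> gverts (F v)" "v' \<in> gverts H" "w' \<in> gverts (F v')"
  shows "{(v, w), (v', w')} \<in> gedges (gen_lex_product H F) \<longleftrightarrow>
           {v, v'} \<in> gedges H \<or> v = v' \<and> {w, w'} \<in> gedges (F v)"
proof
  assume "{(v, w), (v', w')} \<in> gedges (gen_lex_product H F)"
  then show "{v, v'} \<in> gedges H \<or> v = v' \<and> {w, w'} \<in> gedges (F v)"
    by (auto simp: gen_lex_product_def doubleton_eq_iff insert_commute)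
next
  assume "{v, v'} \<in> gedges H \<or> v = v' \<and> {w, w'} \<in> gedges (F v)"
  with assms show "{(v, w), (v', w')} \<in> gedges (gen_lex_product H F)"
    unfolding gen_lex_product_def by simp blast
qed

text \<open>
  The isomorphism \<open>g\<close> sends \<open>u\<close> to the vertex of \<open>K\<^sub>1\<close> and agrees with the given isomorphism
  elsewhere. Simplicity of \<open>\<Gamma>\<close> excludes a loop at \<open>u\<close>, whose image would not be an edge of
  the sum.
\<close>

lemma dominating_vertex_iso_join:
  assumes "simple_graph \<Gamma>" and u: "u \<in> gverts \<Gamma>"
    and dom: "\<And>x. x \<in> gverts \<Gamma> \<Longrightarrow> x \<noteq> u \<Longrightarrow> {u, x} \<in> gedges \<Gamma>"
    and iso: "graph_iso (induced_subgraph \<Gamma> (gverts \<Gamma> - {u})) \<Delta>"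
  shows "graph_iso \<Gamma> (graph_join (K1 c) \<Delta>)"
proof -
  obtain f where f: "bij_betw f (gverts \<Gamma> - {u}) (gverts \<Delta>)"
      and fe: "\<And>x y. x \<in> gverts \<Gamma> - {u} \<Longrightarrow> y \<in> gverts \<Gamma> - {u} \<Longrightarrow>
                 {x, y} \<in> gedges \<Gamma> \<longleftrightarrow> {f x, f y} \<in> gedges \<Delta>"
    using iso by (auto simp: graph_iso_def induced_subgraph_def Int_absorb1)
  define g where "g x = (if x = u then Inl c else Inr (f x))" for x
  have in_\<Delta>: "f x \<in> gverts \<Delta>" if "x \<in> gverts \<Gamma>" "x \<noteq> u" for x
    using f that by (auto simp: bij_betw_def)
  have "inj_on g (gverts \<Gamma>)"
    using f by (auto simp: g_def bij_betw_def inj_on_def)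
  moreover have "g ` gverts \<Gamma> = gverts (graph_join (K1 c) \<Delta>)"
  proof -
    have "g ` gverts \<Gamma> = insert (g u) (g ` (gverts \<Gamma> - {u}))" using u by blast
    also have "g ` (gverts \<Gamma> - {u}) = Inr ` f ` (gverts \<Gamma> - {u})"
      unfolding image_image by (rule image_cong) (auto simp: g_def)
    finally show ?thesis
      using f by (simp add: g_def graph_join_def K1_def bij_betw_def)
  qed
  ultimately have "bij_betw g (gverts \<Gamma>) (gverts (graph_join (K1 c) \<Delta>))"
    by (simp add: bij_betw_def)
  moreover have "{x, y} \<in> gedges \<Gamma> \<longleftrightarrow> {g x, g y} \<in> gedges (graph_join (K1 c) \<Delta>)"
    if x: "x \<in> gverts \<Gamma>" and y: "y \<in> gverts \<Gamma>" for x y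
  proof (cases "x = u"; cases "y = u")
    assume "x = u" "y = u"
    then show ?thesis
      using simple_graph_not_loop[OF assms(1)] join_edge_Inl_Inl[of c c "K1 c" \<Delta>]
      by (simp add: g_def K1_def)
  next
    assume "x = u" "y \<noteq> u"
    then show ?thesis
      using dom y join_edge_Inl_Inr(1)[of c "K1 c" "f y" \<Delta>] in_\<Delta> by (simp add: g_def K1_def)
  next
    assume "x \<noteq> u" "y = u"
    then show ?thesis
      using dom[of x] x join_edge_Inl_Inr(2)[of c "K1 c" "f x" \<Delta>] in_\<Delta>
      by (simp add: g_def K1_def insert_commute)
  next
    assume "x \<noteq> u" "y \<noteq> u"
    then show ?thesis using fe x y by (simp add: g_def join_edge_Inr_Inr)
  qed
  ultimately show ?thesis unfolding graph_iso_def by blast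
qed

text \<open>
  Blowing up the vertex \<open>Inl c\<close> by a single vertex changes nothing, so the sum may be formed
  before or after taking the product. The vertices are only renamed: \<open>Inl c\<close> becomes
  \<open>(Inl c, d)\<close> and \<open>Inr (v, w)\<close> becomes \<open>(Inr v, w)\<close>.
\<close>

lemma join_K1_gen_lex_product_iso:
  "graph_iso (graph_join (K1 c) (gen_lex_product H F))
             (gen_lex_product (graph_join (K1 c) H) (case_sum (\<lambda>_. K1 d) F))"
    (is "graph_iso ?J ?P")
proof -
  let ?f = "case_sum (\<lambda>_. (Inl c, d)) (\<lambda>(v, w). (Inr v, w))"
  let ?H = "graph_join (K1 c) H" and ?F = "case_sum (\<lambda>_. K1 d) F"
  have "bij_betw ?f (gverts ?J) (gverts ?P)"
    unfolding bij_betw_def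
  proof
    show "inj_on ?f (gverts ?J)"
      by (auto simp: inj_on_def graph_join_def K1_def)
    show "?f ` gverts ?J = gverts ?P"
      by (force simp: graph_join_def K1_def gen_lex_product_def image_iff)
  qed
  moreover have "{x, y} \<in> gedges ?J \<longleftrightarrow> {?f x, ?f y} \<in> gedges ?P"
    if x: "x \<in> gverts ?J" and y: "y \<in> gverts ?J" for x y
  proof -
    have pt: "Inl c \<in> gverts ?H" "d \<in> gverts (?F (Inl c))"
      by (simp_all add: graph_join_def K1_def)
    have old: "Inr v \<in> gverts ?H" "w \<in> gverts (?F (Inr v))" "v \<in> gverts H" "w \<in> gverts (F v)"
      if "(v, w) \<in> gverts (gen_lex_product H F)" for v w
      using that by (auto simp: graph_join_def gen_lex_product_def)
    have c: "c \<in> gverts (K1 c)" by (simp add: K1_def)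
    from x consider "x = Inl c" | v w where "x = Inr (v, w)" "(v, w) \<in> gverts (gen_lex_product H F)"
      by (auto simp: graph_join_def K1_def)
    then show ?thesis
    proof cases
      case 1
      from y consider "y = Inl c" | v w where "y = Inr (v, w)" "(v, w) \<in> gverts (gen_lex_product H F)"
        by (auto simp: graph_join_def K1_def)
      then show ?thesis
      proof cases
        case 1
        then show ?thesis
          using \<open>x = Inl c\<close> gen_lex_product_edge_iff[where H = ?H and F = ?F, OF pt pt]
            join_edge_Inl_Inl[of c c "K1 c" H]
            join_edge_Inl_Inl[of c c "K1 c" "gen_lex_product H F"]
          by (simp add: K1_def)
      next
        case (2 v w)
        then show ?thesis
          using \<open>x = Inl c\<close> gen_lex_product_edge_iff[where H = ?H and F = ?F, OF pt old(1,2)[OF 2(2)]]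
            join_edge_Inl_Inr(1)[OF c old(3)[OF 2(2)]] join_edge_Inl_Inr(1)[OF c 2(2)]
          by simp
      qed
    next
      case (2 v w)
      note vw = 2
      from y consider "y = Inl c" | v w where "y = Inr (v, w)" "(v, w) \<in> gverts (gen_lex_product H F)"
        by (auto simp: graph_join_def K1_def)
      then show ?thesis
      proof cases
        case 1
        then show ?thesis
          using vw gen_lex_product_edge_iff[where H = ?H and F = ?F, OF old(1,2)[OF vw(2)] pt]
            join_edge_Inl_Inr(2)[OF c old(3)[OF vw(2)]] join_edge_Inl_Inr(2)[OF c vw(2)]
          by simp
      next
        case (2 v' w')
        then show ?thesis
          using vw gen_lex_product_edge_iff[where H = ?H and F = ?F, OF old(1,2)[OF vw(2)] old(1,2)[OF 2(2)]]
            gen_lex_product_edge_iff[where H = H and F = F, OF old(3,4)[OF vw(2)] old(3,4)[OF 2(2)]]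
          by (simp add: join_edge_Inr_Inr)
      qed
    qed
  qed
  ultimately show ?thesis unfolding graph_iso_def by blast
qed

section \<open>The coprime graph and its order classes\<close>

lemma coprime_graph_edge_iff:
  "{x, y} \<in> gedges (coprime_graph G) \<longleftrightarrow>
     x \<in> carrier G \<and> y \<in> carrier G \<and> x \<noteq> y \<and> gcd (group.ord G x) (group.ord G y) = 1"
  by (auto simp: coprime_graph_def doubleton_eq_iff gcd.commute)

lemma simple_graph_coprime_graph: "simple_graph (coprime_graph G)"
  by (auto simp: simple_graph_def coprime_graph_def)

lemma simple_graph_order_class_graph: "simple_graph (order_class_graph G)"
proof -
  have "same_primes_rel G `` {a} \<in> nonidentity G // same_primes_rel G" if "a \<in> nonidentity G" for a
    using that by (rule quotientI)
  then show ?thesis unfolding simple_graph_def order_class_graph_def by simp blast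
qed

lemma coprime_iff_disjoint_primes:
  fixes m n :: nat
  assumes "m \<noteq> 0"
  shows "gcd m n = 1 \<longleftrightarrow> {p. prime p \<and> p dvd m} \<inter> {p. prime p \<and> p dvd n} = {}"
proof
  assume "gcd m n = 1"
  then have "\<not> prime p" if "p dvd m" "p dvd n" for p
    using that gcd_greatest[of p m n] by auto
  then show "{p. prime p \<and> p dvd m} \<inter> {p. prime p \<and> p dvd n} = {}" by blast
next
  assume disj: "{p. prime p \<and> p dvd m} \<inter> {p. prime p \<and> p dvd n} = {}"
  show "gcd m n = 1"
  proof (rule ccontr)
    assume "gcd m n \<noteq> 1"
    then obtain p where "prime p" "p dvd gcd m n" using prime_factor_nat by blast
    with disj show False by auto
  qed
qed

lemma nonidentity_order_primes_nonempty:
  assumes "group G" and "a \<in> nonidentity G"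
  shows "order_primes G a \<noteq> {}"
proof -
  interpret group G by fact
  have "ord a \<noteq> 1"
    using assms(2) ord_eq_1 by (auto simp: nonidentity_def)
  then show ?thesis
    using prime_factor_nat by (auto simp: order_primes_def)
qed

lemma same_primes_class_eq_iff:
  assumes "a \<in> nonidentity G" and "b \<in> nonidentity G"
  shows "same_primes_rel G `` {a} = same_primes_rel G `` {b} \<longleftrightarrow> order_primes G a = order_primes G b"
  using eq_equiv_class_iff[OF equiv_same_primes_rel assms] assms
  by (simp add: same_primes_rel_def)

text \<open>
  The graph \<open>\<O>\<^sub>G\<close> requires adjacent classes to be distinct, but that is automatic: disjoint
  prime sets of nonidentity elements are different because they are nonempty. The edge set
  is given through representatives, so the equivalence also says that adjacency does not
  depend on the choice of \<open>a\<close> and \<open>b\<close>.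
\<close>

lemma order_class_graph_edge_iff:
  assumes "group G" "a \<in> nonidentity G" "b \<in> nonidentity G"
  shows "{same_primes_rel G `` {a}, same_primes_rel G `` {b}} \<in> gedges (order_class_graph G) \<longleftrightarrow>
           order_primes G a \<inter> order_primes G b = {}"
proof
  assume "{same_primes_rel G `` {a}, same_primes_rel G `` {b}} \<in> gedges (order_class_graph G)"
  then obtain a' b' where ab: "a' \<in> nonidentity G" "b' \<in> nonidentity G"
      "order_primes G a' \<inter> order_primes G b' = {}"
    and "{same_primes_rel G `` {a}, same_primes_rel G `` {b}}
         = {same_primes_rel G `` {a'}, same_primes_rel G `` {b'}}"
    by (auto simp: order_class_graph_def)
  then show "order_primes G a \<inter> order_primes G b = {}"
    using assms by (auto simp: doubleton_eq_iff same_primes_class_eq_iff)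
next
  assume disj: "order_primes G a \<inter> order_primes G b = {}"
  then have "same_primes_rel G `` {a} \<noteq> same_primes_rel G `` {b}"
    using assms nonidentity_order_primes_nonempty[OF assms(1,2)]
    by (auto simp: same_primes_class_eq_iff)
  with disj assms show
    "{same_primes_rel G `` {a}, same_primes_rel G `` {b}} \<in> gedges (order_class_graph G)"
    unfolding order_class_graph_def by simp blast
qed

text \<open>
  Under \<open>x \<mapsto> ([x], x)\<close> both adjacency relations become disjointness of \<open>\<pi>(x)\<close> and \<open>\<pi>(y)\<close>.
  Surjectivity holds because a class is the class of each of its elements.
\<close>

lemma nonidentity_iso_gen_lex_product:
  assumes "group G" and "finite (carrier G)"
  shows "graph_iso (induced_subgraph (coprime_graph G) (nonidentity G))
                   (gen_lex_product (order_class_graph G) (class_family G))"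
    (is "graph_iso ?\<Gamma> ?P")
proof -
  interpret group G by fact
  let ?cl = "\<lambda>x. same_primes_rel G `` {x}"
  let ?f = "\<lambda>x. (?cl x, x)"
  have verts: "gverts ?\<Gamma> = nonidentity G"
    by (auto simp: induced_subgraph_def coprime_graph_def nonidentity_def)
  have class_sub: "A \<subseteq> nonidentity G" if "A \<in> nonidentity G // same_primes_rel G" for A
    using that by (auto simp: quotient_def same_primes_rel_def)
  have fam_verts: "gverts (class_family G A) = A" if "A \<in> nonidentity G // same_primes_rel G" for A
    using class_sub[OF that]
    by (auto simp: class_family_def induced_subgraph_def coprime_graph_def nonidentity_def)
  have cl: "?cl x \<in> nonidentity G // same_primes_rel G" "x \<in> ?cl x" if "x \<in> nonidentity G" for x
    using that by (simp_all add: quotientI) (simp add: same_primes_rel_def)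
  have "?f ` nonidentity G = gverts ?P"
  proof
    show "?f ` nonidentity G \<subseteq> gverts ?P"
      using cl fam_verts by (auto simp: gen_lex_product_def order_class_graph_def)
    show "gverts ?P \<subseteq> ?f ` nonidentity G"
    proof
      fix p assume "p \<in> gverts ?P"
      then obtain A x where p: "p = (A, x)" and A: "A \<in> nonidentity G // same_primes_rel G"
        and x: "x \<in> A"
        using fam_verts by (auto simp: gen_lex_product_def order_class_graph_def)
      have xn: "x \<in> nonidentity G" using class_sub A x by blast
      have "A = ?cl x"
        by (rule quotient_eqI[OF equiv_same_primes_rel A cl(1)[OF xn] x cl(2)[OF xn]])
          (use xn in \<open>simp add: same_primes_rel_def\<close>)
      with p xn show "p \<in> ?f ` nonidentity G" by blast
    qed
  qed
  then have "bij_betw ?f (gverts ?\<Gamma>) (gverts ?P)"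
    by (auto simp: verts bij_betw_def inj_on_def)
  moreover have "{x, y} \<in> gedges ?\<Gamma> \<longleftrightarrow> {?f x, ?f y} \<in> gedges ?P"
    if x: "x \<in> nonidentity G" and y: "y \<in> nonidentity G" for x y
  proof -
    have carr: "x \<in> carrier G" "y \<in> carrier G" using x y by (auto simp: nonidentity_def)
    have "ord x \<noteq> 0" using ord_ge_1[OF assms(2) carr(1)] by simp
    then have gcd_iff: "gcd (ord x) (ord y) = 1 \<longleftrightarrow> order_primes G x \<inter> order_primes G y = {}"
      unfolding order_primes_def by (rule coprime_iff_disjoint_primes)
    have ne: "order_primes G x \<noteq> {}" using assms(1) x by (rule nonidentity_order_primes_nonempty)
    have "{x, y} \<in> gedges ?\<Gamma> \<longleftrightarrow> order_primes G x \<inter> order_primes G y = {}"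
      using x y carr gcd_iff ne
      by (auto simp: induced_subgraph_def coprime_graph_edge_iff)
    moreover have "{?f x, ?f y} \<in> gedges ?P \<longleftrightarrow> {?cl x, ?cl y} \<in> gedges (order_class_graph G)
        \<or> ?cl x = ?cl y \<and> {x, y} \<in> gedges (class_family G (?cl x))"
      using cl x y fam_verts
      by (intro gen_lex_product_edge_iff) (auto simp: order_class_graph_def)
    \<comment> \<open>A class induces no edges: its elements share a nonempty set of prime divisors.\<close>
    moreover have "{x, y} \<notin> gedges (class_family G (?cl x))" if "?cl x = ?cl y"
      using that x y gcd_iff ne
      by (auto simp: same_primes_class_eq_iff class_family_def induced_subgraph_def
          coprime_graph_edge_iff)
    ultimately show ?thesis
      using order_class_graph_edge_iff[OF assms(1) x y] by blast
  qed
  ultimately show ?thesis unfolding graph_iso_def verts by blast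
qed

theorem proposition4p2:
  fixes G :: "('a, 'b) monoid_scheme"
  assumes "group G" and "finite (carrier G)"
  shows
    "graph_iso (induced_subgraph (coprime_graph G) (carrier G - {\<one>\<^bsub>G\<^esub>}))
               (gen_lex_product (order_class_graph G) (class_family G))
     \<and> (\<exists>(H :: (unit + 'a set) ugraph) (F :: unit + 'a set \<Rightarrow> 'a ugraph).
          H = graph_join (K1 ()) (order_class_graph G)
          \<and> F = case_sum (\<lambda>_. K1 \<one>\<^bsub>G\<^esub>) (class_family G)
          \<and> simple_graph H \<and> (\<forall>v \<in> gverts H. simple_graph (F v))
          \<and> graph_iso (coprime_graph G) (gen_lex_product H F))
     \<and> graph_iso (coprime_graph G)
                 (graph_join (K1 ()) (gen_lex_product (order_class_graph G) (class_family G)))"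
proof -
  interpret group G by fact
  let ?O = "order_class_graph G" and ?L = "class_family G"
  have ni: "carrier G - {\<one>\<^bsub>G\<^esub>} = nonidentity G" by (simp add: nonidentity_def)
  have iso: "graph_iso (induced_subgraph (coprime_graph G) (carrier G - {\<one>\<^bsub>G\<^esub>}))
               (gen_lex_product ?O ?L)"
    unfolding ni using assms by (rule nonidentity_iso_gen_lex_product)
  have verts: "gverts (coprime_graph G) = carrier G" by (simp add: coprime_graph_def)
  have join: "graph_iso (coprime_graph G) (graph_join (K1 ()) (gen_lex_product ?O ?L))"
  proof (rule dominating_vertex_iso_join)
    show "{\<one>\<^bsub>G\<^esub>, x} \<in> gedges (coprime_graph G)"
      if "x \<in> gverts (coprime_graph G)" "x \<noteq> \<one>\<^bsub>G\<^esub>" for x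
      using that by (auto simp: verts coprime_graph_edge_iff)
  qed (use iso simple_graph_coprime_graph in \<open>simp_all add: verts\<close>)
  let ?H = "graph_join (K1 ()) ?O" and ?F = "case_sum (\<lambda>_. K1 \<one>\<^bsub>G\<^esub>) ?L"
  have "graph_iso (coprime_graph G) (gen_lex_product ?H ?F)"
    using join join_K1_gen_lex_product_iso by (rule graph_iso_trans)
  moreover have "simple_graph ?H"
    by (intro simple_graph_join simple_graph_K1 simple_graph_order_class_graph)
  moreover have "simple_graph (?F v)" for v
    by (cases v) (simp_all add: simple_graph_K1 class_family_def simple_graph_induced_subgraph
        simple_graph_coprime_graph)
  ultimately show ?thesis using iso join by blast
qed

end
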